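(* Let $\Bbbk$ be an algebraically closed field with $\operatorname{char}(\Bbbk)\neq 2$, let $\mu_{12}\in\Bbbk^\times$, $\mu_{21}=\mu_{12}^{-1}$, and let $S$ be the $\Bbbk$-algebra on generators $z_1,z_2$ with defining relation $z_2z_1=\mu_{12}z_1z_2$, graded with $z_1,z_2$ in degree one. Let $Q=a z_1^2+2b z_1z_2+c z_2^2\in S_2$ be a nonzero quadratic form, where $a,b,c\in\Bbbk$, with associated $\mu$-symmetric matrix $M=\begin{bmatrix} a & b\\ \mu_{21}b & c\end{bmatrix}$, and let $D(M)=4b^2-(1+\mu_{12})^2ac$. Then: (a) There exist $L_1,L_2\in S_1$ such that $Q=L_1L_2$ in $S$. (b) There exists $L\in S_1$ such that $Q=L^2$ in $S$ if and only if $D(M)=0$. (c) The element $Q$ factors uniquely in $S$, up to a nonzero scalar multiple, if and only if $b^2=\mu_{12}ac$.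
   Context: $S_i$ denotes the span of the homogeneous elements of $S$ of degree $i$; $S_2$ has basis $z_1^2,\ z_1z_2,\ z_2^2$. A quadratic form is any element of $S_2$. All products are computed in $S$. "$Q$ factors uniquely, up to a nonzero scalar multiple, in $S$" means: $Q=L_1L_2$ for some $L_1,L_2\in S_1$, and whenever $Q=L_1L_2=L_1'L_2'$ with $L_1,L_2,L_1',L_2'\in S_1$, there is $\lambda\in\Bbbk^\times$ with $L_1'=\lambda L_1$ and $L_2'=\lambda^{-1}L_2$. $D(M)$ is called the $\mu$-determinant of $M$. *)

theory Defs
  imports
    "HOL-Analysis.Cartesian_Space"
    "HOL-Algebra.Algebra"
    "HOL-Algebra.Algebraic_Closure_Type"
    "HOL-Library.Poly_Mapping"
begin

datatype letter = Z1 | Z2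

datatype word = Word (letters: "letter list")

instantiation word :: monoid_add
begin

text \<open>The sum of two words is their concatenation and \<open>0\<close> is the empty word, so that the
  convolution product of \<^theory>\<open>HOL-Library.Poly_Mapping\<close> makes \<open>word \<Rightarrow>\<^sub>0 'k\<close> the free associative
  algebra on two generators.\<close>

definition zero_word :: word where "0 = Word []"

definition plus_word :: "word \<Rightarrow> word \<Rightarrow> word" where
  "u + v = Word (letters u @ letters v)"

instance by standard (simp_all add: zero_word_def plus_word_def)

end

type_synonym 'k free_algebra = "word \<Rightarrow>\<^sub>0 'k"

abbreviation free_ring :: "'k::field free_algebra ring" where
  "free_ring \<equiv> ring_of_type_algebra"

definition gen :: "letter \<Rightarrow> 'k::field free_algebra" where
  "gen x = Poly_Mapping.single (Word [x]) 1"

definition const :: "'k::field \<Rightarrow> 'k free_algebra" where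
  "const c = Poly_Mapping.single 0 c"

definition rel_ideal :: "'k::field \<Rightarrow> 'k free_algebra set" where
  "rel_ideal \<mu> = Idl\<^bsub>free_ring\<^esub> {gen Z2 * gen Z1 - const \<mu> * (gen Z1 * gen Z2)}"

text \<open>In the names below, the parameter \<open>\<mu>\<close> is \<open>\<mu>\<^sub>1\<^sub>2\<close>. The elements of \<open>skew_ring \<mu>\<close> are cosets
  of the two-sided ideal \<open>rel_ideal \<mu>\<close>; scalars act through their images in the quotient.\<close>

definition skew_ring :: "'k::field \<Rightarrow> 'k free_algebra set ring" where
  "skew_ring \<mu> = free_ring Quot rel_ideal \<mu>"

definition cls :: "'k::field \<Rightarrow> 'k free_algebra \<Rightarrow> 'k free_algebra set" where
  "cls \<mu> f = rel_ideal \<mu> +>\<^bsub>free_ring\<^esub> f"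

definition z1 :: "'k::field \<Rightarrow> 'k free_algebra set" where "z1 \<mu> = cls \<mu> (gen Z1)"

definition z2 :: "'k::field \<Rightarrow> 'k free_algebra set" where "z2 \<mu> = cls \<mu> (gen Z2)"

definition scal :: "'k::field \<Rightarrow> 'k \<Rightarrow> 'k free_algebra set \<Rightarrow> 'k free_algebra set" where
  "scal \<mu> c x = cls \<mu> (const c) \<otimes>\<^bsub>skew_ring \<mu>\<^esub> x"

text \<open>The defining relation is homogeneous, so the grading of the free algebra by word length
  descends to the quotient.\<close>

definition graded_part :: "'k::field \<Rightarrow> nat \<Rightarrow> 'k free_algebra set set" where
  "graded_part \<mu> i = cls \<mu> ` {f. \<forall>w \<in> Poly_Mapping.keys f. length (letters w) = i}"

definition quadratic_form :: "'k::field \<Rightarrow> 'k \<Rightarrow> 'k \<Rightarrow> 'k \<Rightarrow> 'k free_algebra set" where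
  "quadratic_form \<mu> a b c =
     scal \<mu> a (z1 \<mu> [^]\<^bsub>skew_ring \<mu>\<^esub> (2::nat))
     \<oplus>\<^bsub>skew_ring \<mu>\<^esub> scal \<mu> (2 * b) (z1 \<mu> \<otimes>\<^bsub>skew_ring \<mu>\<^esub> z2 \<mu>)
     \<oplus>\<^bsub>skew_ring \<mu>\<^esub> scal \<mu> c (z2 \<mu> [^]\<^bsub>skew_ring \<mu>\<^esub> (2::nat))"

definition mu_determinant :: "'k::field \<Rightarrow> 'k^2^2 \<Rightarrow> 'k" where
  "mu_determinant \<mu> M = 4 * (M $ 1 $ 2)^2 - (1 + \<mu>)^2 * (M $ 1 $ 1) * (M $ 2 $ 2)"

definition factors_uniquely :: "'k::field \<Rightarrow> 'k free_algebra set \<Rightarrow> bool" where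
  "factors_uniquely \<mu> Q \<longleftrightarrow>
     (\<exists>L1 \<in> graded_part \<mu> 1. \<exists>L2 \<in> graded_part \<mu> 1. Q = L1 \<otimes>\<^bsub>skew_ring \<mu>\<^esub> L2) \<and>
     (\<forall>L1 \<in> graded_part \<mu> 1. \<forall>L2 \<in> graded_part \<mu> 1.
      \<forall>L1' \<in> graded_part \<mu> 1. \<forall>L2' \<in> graded_part \<mu> 1.
        Q = L1 \<otimes>\<^bsub>skew_ring \<mu>\<^esub> L2 \<longrightarrow> Q = L1' \<otimes>\<^bsub>skew_ring \<mu>\<^esub> L2' \<longrightarrow>
        (\<exists>l. l \<noteq> 0 \<and> L1' = scal \<mu> l L1 \<and> L2' = scal \<mu> (inverse l) L2))"

end

theory Submission
  imports Defs
begin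

text \<open>In degree one every element is a linear form \<open>p z\<^sub>1 + q z\<^sub>2\<close>, and the product of \<open>p z\<^sub>1 + q z\<^sub>2\<close>
  and \<open>r z\<^sub>1 + s z\<^sub>2\<close> is \<open>p r z\<^sub>1\<^sup>2 + (p s + \<mu> q r) z\<^sub>1 z\<^sub>2 + q s z\<^sub>2\<^sup>2\<close>. The monomials \<open>z\<^sub>1\<^sup>2\<close>, \<open>z\<^sub>1 z\<^sub>2\<close>, \<open>z\<^sub>2\<^sup>2\<close>
  are linearly independent in the quotient, because the polynomials without terms of degree at most
  one on which the coefficients of \<open>z\<^sub>1\<^sup>2\<close> and \<open>z\<^sub>2\<^sup>2\<close> and the combination
  (coefficient of \<open>z\<^sub>1 z\<^sub>2\<close>) + \<open>\<mu>\<close> (coefficient of \<open>z\<^sub>2 z\<^sub>1\<close>) vanish form an ideal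
  containing the defining relation. Hence factoring \<open>Q\<close> means solving \<open>a = p r\<close>,
  \<open>2 b = p s + \<mu> q r\<close>, \<open>c = q s\<close>. These equations give \<open>4 (b\<^sup>2 - \<mu> a c) = (p s - \<mu> q r)\<^sup>2\<close>, and they are
  invariant under \<open>(p, q, r, s) \<mapsto> (r, s / \<mu>, p, \<mu> q)\<close>. So every factorization comes with a second one,
  whose left factor is proportional to the first exactly when \<open>p s = \<mu> q r\<close>.\<close>

section \<open>The free algebra as a ring, and coefficients of its products\<close>

lemma ring_of_type_algebra_simps [simp]:
  "carrier ring_of_type_algebra = UNIV"
  "x \<otimes>\<^bsub>ring_of_type_algebra\<^esub> y = x * y"
  "x \<oplus>\<^bsub>ring_of_type_algebra\<^esub> y = x + y"
  "\<one>\<^bsub>ring_of_type_algebra\<^esub> = 1"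
  "\<zero>\<^bsub>ring_of_type_algebra\<^esub> = 0"
  by (simp_all add: ring_of_type_algebra_def)

lemma ring_free_ring: "ring (free_ring :: 'k::field free_algebra ring)"
proof -
  have "\<exists>y. x + y = 0" for x :: "'k free_algebra"
    using add.right_inverse by blast
  then show ?thesis
    unfolding ring_of_type_algebra_def using add.right_inverse
    by unfold_locales (auto simp: algebra_simps Units_def)
qed

lemma a_minus_free_ring [simp]: "f \<ominus>\<^bsub>free_ring\<^esub> g = f - (g :: 'k::field free_algebra)"
proof -
  interpret ring "free_ring :: 'k free_algebra ring" by (rule ring_free_ring)
  have "\<ominus>\<^bsub>free_ring\<^esub> g = - g"
    using minus_equality[of "- g" g] by simp
  then show ?thesis by (simp add: a_minus_def)
qed

lemma Word_plus [simp]: "Word u + Word v = Word (u @ v)"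
  by (simp add: plus_word_def)

text \<open>The decompositions of a word into two words are its cuts into a prefix and a suffix, so
  the convolution sum runs over the \<open>length w + 1\<close> cut positions.\<close>

lemma lookup_mult_Word:
  fixes f g :: "'k::field free_algebra"
  shows "Poly_Mapping.lookup (f * g) (Word w) =
    (\<Sum>i\<le>length w. Poly_Mapping.lookup f (Word (take i w)) * Poly_Mapping.lookup g (Word (drop i w)))"
proof -
  define h where "h l = Poly_Mapping.lookup f l * (\<Sum>q. Poly_Mapping.lookup g q when Word w = l + q)" for l
  let ?A = "(\<lambda>i. Word (take i w)) ` {..length w}"
  have split: "Word w = l + q \<longleftrightarrow> (\<exists>i\<le>length w. l = Word (take i w) \<and> q = Word (drop i w))" for l q
    by (cases l; cases q) (auto simp: append_eq_conv_conj intro!: exI[of _ "length (letters l)"])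
  have "h l = 0" if "l \<notin> ?A" for l
  proof -
    have "Word w \<noteq> l + q" for q
      using that split by blast
    then show ?thesis by (simp add: h_def)
  qed
  then have "{l. h l \<noteq> 0} \<subseteq> ?A" by blast
  then have "Poly_Mapping.lookup (f * g) (Word w) = sum h ?A"
    unfolding lookup_mult h_def[symmetric] by (intro Sum_any.expand_superset) auto
  also have "\<dots> = (\<Sum>i\<le>length w. h (Word (take i w)))"
  proof (rule sum.reindex_cong[OF _ refl refl])
    show "inj_on (\<lambda>i. Word (take i w)) {..length w}"
    proof (rule inj_onI)
      fix i j assume "i \<in> {..length w}" "j \<in> {..length w}" "Word (take i w) = Word (take j w)"
      then have "length (take i w) = length (take j w)" "i \<le> length w" "j \<le> length w" by auto
      then show "i = j" by simp
    qed
  qed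
  also have "\<dots> = (\<Sum>i\<le>length w. Poly_Mapping.lookup f (Word (take i w)) * Poly_Mapping.lookup g (Word (drop i w)))"
  proof (rule sum.cong[OF refl])
    fix i assume "i \<in> {..length w}"
    have "Word w = Word (take i w) + q \<longleftrightarrow> Word (drop i w) = q" for q
    proof (cases q)
      case (Word v)
      have "w = take i w @ v \<longleftrightarrow> drop i w = v"
        by (metis append_take_drop_id same_append_eq)
      then show ?thesis using Word by simp
    qed
    then show "h (Word (take i w)) =
        Poly_Mapping.lookup f (Word (take i w)) * Poly_Mapping.lookup g (Word (drop i w))"
      by (simp add: h_def)
  qed
  finally show ?thesis .
qed

lemma lookup_mult_Word_simps:
  fixes f g :: "'k::field free_algebra"
  shows "Poly_Mapping.lookup (f * g) (Word []) =
      Poly_Mapping.lookup f (Word []) * Poly_Mapping.lookup g (Word [])"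
    and "Poly_Mapping.lookup (f * g) (Word [x]) =
      Poly_Mapping.lookup f (Word []) * Poly_Mapping.lookup g (Word [x])
      + Poly_Mapping.lookup f (Word [x]) * Poly_Mapping.lookup g (Word [])"
    and "Poly_Mapping.lookup (f * g) (Word [x, y]) =
      Poly_Mapping.lookup f (Word []) * Poly_Mapping.lookup g (Word [x, y])
      + Poly_Mapping.lookup f (Word [x]) * Poly_Mapping.lookup g (Word [y])
      + Poly_Mapping.lookup f (Word [x, y]) * Poly_Mapping.lookup g (Word [])"
  by (simp_all add: lookup_mult_Word atMost_Suc)

section \<open>An ideal that separates the quadratic monomials\<close>

definition quadratic_vanishing :: "'k::field \<Rightarrow> 'k free_algebra set" where
  "quadratic_vanishing \<mu> = {f. Poly_Mapping.lookup f (Word []) = 0 \<and> (\<forall>x. Poly_Mapping.lookup f (Word [x]) = 0)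
     \<and> (\<forall>x. Poly_Mapping.lookup f (Word [x, x]) = 0)
     \<and> Poly_Mapping.lookup f (Word [Z1, Z2]) + \<mu> * Poly_Mapping.lookup f (Word [Z2, Z1]) = 0}"

text \<open>An element of the set has no terms below degree two. A product with \<open>g\<close> on
  either side therefore multiplies its quadratic coefficients by the constant term of
  \<open>g\<close>, which preserves the linear conditions.\<close>

lemma ideal_quadratic_vanishing: "ideal (quadratic_vanishing \<mu>) free_ring"
proof (rule idealI[OF ring_free_ring])
  interpret ring "free_ring :: 'a free_algebra ring" by (rule ring_free_ring)
  show "subgroup (quadratic_vanishing \<mu>) (add_monoid free_ring)"
  proof (rule add.subgroupI)
    show "quadratic_vanishing \<mu> \<noteq> {}"
      by (auto simp: quadratic_vanishing_def intro!: exI[of _ 0])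
  next
    fix f assume "f \<in> quadratic_vanishing \<mu>"
    moreover have "\<ominus>\<^bsub>free_ring\<^esub> f = - f"
      using minus_equality[of "- f" f] by simp
    ultimately show "\<ominus>\<^bsub>free_ring\<^esub> f \<in> quadratic_vanishing \<mu>"
      by (auto simp: quadratic_vanishing_def add_eq_0_iff)
  next
    fix f g assume "f \<in> quadratic_vanishing \<mu>" "g \<in> quadratic_vanishing \<mu>"
    then show "f \<oplus>\<^bsub>free_ring\<^esub> g \<in> quadratic_vanishing \<mu>"
      by (auto simp: quadratic_vanishing_def lookup_add add_eq_0_iff algebra_simps)
  qed simp
next
  fix f g :: "'a free_algebra" assume f: "f \<in> quadratic_vanishing \<mu>"
  then have f': "Poly_Mapping.lookup f (Word [Z1, Z2]) = - (\<mu> * Poly_Mapping.lookup f (Word [Z2, Z1]))"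
    by (simp add: quadratic_vanishing_def add_eq_0_iff2)
  show "g \<otimes>\<^bsub>free_ring\<^esub> f \<in> quadratic_vanishing \<mu>" "f \<otimes>\<^bsub>free_ring\<^esub> g \<in> quadratic_vanishing \<mu>"
    using f by (auto simp: quadratic_vanishing_def lookup_mult_Word_simps f' algebra_simps)
qed

abbreviation relator :: "'k::field \<Rightarrow> 'k free_algebra" where
  "relator \<mu> \<equiv> gen Z2 * gen Z1 - const \<mu> * (gen Z1 * gen Z2)"

lemma relator_eq:
  "relator \<mu> = Poly_Mapping.single (Word [Z2, Z1]) 1 - Poly_Mapping.single (Word [Z1, Z2]) \<mu>"
  by (simp add: gen_def const_def mult_single)

lemma rel_ideal_subset_quadratic_vanishing: "rel_ideal \<mu> \<subseteq> quadratic_vanishing \<mu>"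
  unfolding rel_ideal_def
  by (rule ring.genideal_minimal[OF ring_free_ring ideal_quadratic_vanishing])
    (simp add: relator_eq quadratic_vanishing_def lookup_minus lookup_single when_def)

section \<open>The quotient ring and its class map\<close>

lemma ideal_rel_ideal: "ideal (rel_ideal \<mu>) free_ring"
  unfolding rel_ideal_def by (rule ring.genideal_ideal[OF ring_free_ring]) simp

lemma relator_in_rel_ideal: "relator \<mu> \<in> rel_ideal \<mu>"
  unfolding rel_ideal_def by (rule ring.genideal_self'[OF ring_free_ring]) simp

lemma ring_skew_ring: "ring (skew_ring \<mu>)"
  unfolding skew_ring_def by (rule ideal.quotient_is_ring[OF ideal_rel_ideal])

lemma cls_ring_hom: "cls \<mu> \<in> ring_hom free_ring (skew_ring \<mu>)"
  unfolding skew_ring_def cls_def[abs_def] by (rule ideal.rcos_ring_hom[OF ideal_rel_ideal])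

lemma cls_mult: "cls \<mu> f \<otimes>\<^bsub>skew_ring \<mu>\<^esub> cls \<mu> g = cls \<mu> (f * g)"
  using ring_hom_mult[OF cls_ring_hom, of f g] by simp

lemma cls_add: "cls \<mu> f \<oplus>\<^bsub>skew_ring \<mu>\<^esub> cls \<mu> g = cls \<mu> (f + g)"
  using ring_hom_add[OF cls_ring_hom, of f g] by simp

lemma cls_closed: "cls \<mu> f \<in> carrier (skew_ring \<mu>)"
  using ring_hom_closed[OF cls_ring_hom, of f] by simp

lemma cls_zero: "cls \<mu> 0 = \<zero>\<^bsub>skew_ring \<mu>\<^esub>"
  using ring_hom_zero[OF cls_ring_hom ring_free_ring ring_skew_ring] by simp

lemma cls_eq_iff: "cls \<mu> f = cls \<mu> g \<longleftrightarrow> f - g \<in> rel_ideal \<mu>"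
  using ring.quotient_eq_iff_same_a_r_cos[OF ring_free_ring ideal_rel_ideal, of f g]
  by (simp add: cls_def)

lemma cls_square: "cls \<mu> f [^]\<^bsub>skew_ring \<mu>\<^esub> (2::nat) = cls \<mu> (f * f)"
proof -
  interpret ring "skew_ring \<mu>" by (rule ring_skew_ring)
  show ?thesis by (simp add: numeral_2_eq_2 cls_closed cls_mult)
qed

section \<open>Linear and quadratic forms in coordinates\<close>

definition lin_form :: "'k::field \<Rightarrow> 'k \<Rightarrow> 'k \<Rightarrow> 'k free_algebra set" where
  "lin_form \<mu> p q = cls \<mu> (Poly_Mapping.single (Word [Z1]) p + Poly_Mapping.single (Word [Z2]) q)"

text \<open>Normal form in the ordered monomials. The middle coefficient is an arbitrary
  \<open>d\<close> instead of \<open>2 * b\<close>, so that products of linear forms need no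
  division by 2.\<close>

definition quad_form :: "'k::field \<Rightarrow> 'k \<Rightarrow> 'k \<Rightarrow> 'k \<Rightarrow> 'k free_algebra set" where
  "quad_form \<mu> a d c = cls \<mu> (Poly_Mapping.single (Word [Z1, Z1]) a
     + Poly_Mapping.single (Word [Z1, Z2]) d + Poly_Mapping.single (Word [Z2, Z2]) c)"

lemma quadratic_form_eq: "quadratic_form \<mu> a b c = quad_form \<mu> a (2 * b) c"
  by (simp add: quadratic_form_def quad_form_def scal_def z1_def z2_def cls_square cls_mult cls_add
      gen_def const_def mult_single)

lemma quad_form_zero: "quad_form \<mu> 0 0 0 = \<zero>\<^bsub>skew_ring \<mu>\<^esub>"
  by (simp add: quad_form_def cls_zero)

lemma quad_form_eq_iff:
  "quad_form \<mu> a d c = quad_form \<mu> a' d' c' \<longleftrightarrow> a = a' \<and> d = d' \<and> c = c'"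
proof
  assume "quad_form \<mu> a d c = quad_form \<mu> a' d' c'"
  then have *: "Poly_Mapping.single (Word [Z1, Z1]) a
      + Poly_Mapping.single (Word [Z1, Z2]) d + Poly_Mapping.single (Word [Z2, Z2]) c
      - (Poly_Mapping.single (Word [Z1, Z1]) a'
      + Poly_Mapping.single (Word [Z1, Z2]) d' + Poly_Mapping.single (Word [Z2, Z2]) c')
      \<in> quadratic_vanishing \<mu>"
    unfolding quad_form_def cls_eq_iff using rel_ideal_subset_quadratic_vanishing by blast
  \<comment> \<open>This splits the quantifiers over letters in \<open>quadratic_vanishing\<close>,
    so that each coefficient can be evaluated.\<close>
  have "(\<forall>x. P x) \<longleftrightarrow> P Z1 \<and> P Z2" for P
    by (metis letter.exhaust)
  with * show "a = a' \<and> d = d' \<and> c = c'"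
    by (simp add: quadratic_vanishing_def lookup_add lookup_minus lookup_single when_def)
qed simp

text \<open>The only unordered term of the product is q r z2 z1; subtracting q r times the relator
  replaces it by \<mu> q r z1 z2.\<close>

lemma lin_form_mult:
  "lin_form \<mu> p q \<otimes>\<^bsub>skew_ring \<mu>\<^esub> lin_form \<mu> r s = quad_form \<mu> (p * r) (p * s + \<mu> * q * r) (q * s)"
proof -
  have "const (q * r) * relator \<mu> \<in> rel_ideal \<mu>"
    using ideal.I_l_closed[OF ideal_rel_ideal relator_in_rel_ideal, of "const (q * r)" \<mu>] by simp
  also have "const (q * r) * relator \<mu> =
      Poly_Mapping.single (Word [Z2, Z1]) (q * r) - Poly_Mapping.single (Word [Z1, Z2]) (\<mu> * q * r)"
    unfolding relator_eq by (simp add: const_def mult_single algebra_simps)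
  finally show ?thesis
    unfolding lin_form_def quad_form_def cls_mult cls_eq_iff
    by (simp add: algebra_simps mult_single single_add)
qed

lemma lin_form_square:
  "lin_form \<mu> p q [^]\<^bsub>skew_ring \<mu>\<^esub> (2::nat) = quad_form \<mu> (p^2) ((1 + \<mu>) * p * q) (q^2)"
proof -
  have "lin_form \<mu> p q [^]\<^bsub>skew_ring \<mu>\<^esub> (2::nat) = lin_form \<mu> p q \<otimes>\<^bsub>skew_ring \<mu>\<^esub> lin_form \<mu> p q"
    by (simp add: lin_form_def cls_square cls_mult)
  then show ?thesis
    by (simp add: lin_form_mult power2_eq_square algebra_simps)
qed

lemma scal_lin_form: "scal \<mu> l (lin_form \<mu> p q) = lin_form \<mu> (l * p) (l * q)"
  by (simp add: scal_def lin_form_def cls_mult const_def mult_single distrib_left)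

text \<open>Right multiplication by \<open>z\<^sub>1\<close> reduces this to degree two.\<close>

lemma lin_form_eq_iff:
  assumes "\<mu> \<noteq> 0"
  shows "lin_form \<mu> p q = lin_form \<mu> p' q' \<longleftrightarrow> p = p' \<and> q = q'"
proof
  assume "lin_form \<mu> p q = lin_form \<mu> p' q'"
  then have "lin_form \<mu> p q \<otimes>\<^bsub>skew_ring \<mu>\<^esub> lin_form \<mu> 1 0 = lin_form \<mu> p' q' \<otimes>\<^bsub>skew_ring \<mu>\<^esub> lin_form \<mu> 1 0"
    by simp
  then show "p = p' \<and> q = q'"
    using assms by (simp add: lin_form_mult quad_form_eq_iff)
qed simp

text \<open>A word of length one is a single letter, so a homogeneous element of degree one has at
  most two coefficients. Quantifiers over linear forms thus become quantifiers over scalars.\<close>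

lemma graded_part_1: "graded_part \<mu> 1 = {lin_form \<mu> p q | p q. True}"
proof (intro equalityI subsetI)
  fix L assume "L \<in> graded_part \<mu> 1"
  then obtain f where L: "L = cls \<mu> f" and f: "\<forall>w \<in> Poly_Mapping.keys f. length (letters w) = 1"
    by (auto simp: graded_part_def)
  have "f = Poly_Mapping.single (Word [Z1]) (Poly_Mapping.lookup f (Word [Z1]))
    + Poly_Mapping.single (Word [Z2]) (Poly_Mapping.lookup f (Word [Z2]))"
  proof (rule poly_mapping_eqI)
    fix w
    show "Poly_Mapping.lookup f w = Poly_Mapping.lookup (Poly_Mapping.single (Word [Z1]) (Poly_Mapping.lookup f (Word [Z1]))
      + Poly_Mapping.single (Word [Z2]) (Poly_Mapping.lookup f (Word [Z2]))) w"
    proof (cases "w \<in> {Word [Z1], Word [Z2]}")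
      case True
      then show ?thesis by (auto simp: lookup_add lookup_single when_def)
    next
      case False
      have "length (letters w) \<noteq> 1"
      proof
        assume "length (letters w) = 1"
        then obtain x where "w = Word [x]"
          by (cases w) (auto simp: length_Suc_conv)
        with False show False by (cases x) auto
      qed
      with f have "w \<notin> Poly_Mapping.keys f" by blast
      with False show ?thesis by (auto simp: lookup_add lookup_single when_def in_keys_iff)
    qed
  qed
  from trans[OF L arg_cong[OF this, of "cls \<mu>"]] show "L \<in> {lin_form \<mu> p q | p q. True}"
    unfolding lin_form_def by blast
next
  fix L assume "L \<in> {lin_form \<mu> p q | p q. True}"
  then obtain p q where L: "L = lin_form \<mu> p q" by blast
  have "length (letters w) = 1"
    if "w \<in> Poly_Mapping.keys (Poly_Mapping.single (Word [Z1]) p + Poly_Mapping.single (Word [Z2]) q)" for w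
    using that by (auto simp: in_keys_iff lookup_add lookup_single when_def split: if_splits)
  then show "L \<in> graded_part \<mu> 1" unfolding L lin_form_def graded_part_def by blast
qed

lemma bex_graded_part_1: "(\<exists>L \<in> graded_part \<mu> 1. P L) \<longleftrightarrow> (\<exists>p q. P (lin_form \<mu> p q))"
  unfolding graded_part_1 by blast

lemma ball_graded_part_1: "(\<forall>L \<in> graded_part \<mu> 1. P L) \<longleftrightarrow> (\<forall>p q. P (lin_form \<mu> p q))"
  unfolding graded_part_1 by blast

section \<open>Existence of factorizations and of square roots\<close>

lemma monic_quadratic_has_root:
  fixes d e :: "'k::alg_closed_field"
  shows "\<exists>x. x^2 - d * x + e = 0"
proof -
  obtain x where "poly [:e, - d, 1:] x = 0"
    using alg_closed_imp_poly_has_root[of "[:e, - d, 1:]"] by auto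
  then have "x^2 - d * x + e = 0"
    by (simp add: algebra_simps power2_eq_square)
  then show ?thesis ..
qed

lemma quad_form_factors:
  fixes \<mu> :: "'k::alg_closed_field"
  assumes "\<mu> \<noteq> 0"
  shows "\<exists>p q r s. quad_form \<mu> a d c = lin_form \<mu> p q \<otimes>\<^bsub>skew_ring \<mu>\<^esub> lin_form \<mu> r s"
proof (cases "a = 0")
  case True
  \<comment> \<open>Without a z1^2 term, z2 splits off on the left; moving it past z1 costs a factor
    \<mu>, hence \<open>d / \<mu>\<close>.\<close>
  then have "quad_form \<mu> a d c = lin_form \<mu> 0 1 \<otimes>\<^bsub>skew_ring \<mu>\<^esub> lin_form \<mu> (d / \<mu>) c"
    using assms by (simp add: lin_form_mult)
  then show ?thesis by blast
next
  case False
  \<comment> \<open>Normalize p = 1, so that r = a. The middle coefficient gives q = (d - s) /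
    (\<mu> a), and then q s = c is this quadratic equation for s.\<close>
  obtain s where s: "s^2 - d * s + \<mu> * a * c = 0"
    using monic_quadratic_has_root[of d "\<mu> * a * c"] by blast
  have "(d - s) * s = \<mu> * a * c"
    using s by (simp add: algebra_simps power2_eq_square)
  then have "quad_form \<mu> a d c = lin_form \<mu> 1 ((d - s) / (\<mu> * a)) \<otimes>\<^bsub>skew_ring \<mu>\<^esub> lin_form \<mu> a s"
    using assms False by (simp add: lin_form_mult quad_form_eq_iff)
  then show ?thesis by blast
qed

lemma quad_form_is_square_iff:
  fixes \<mu> :: "'k::alg_closed_field"
  shows "(\<exists>p q. quad_form \<mu> a d c = lin_form \<mu> p q [^]\<^bsub>skew_ring \<mu>\<^esub> (2::nat))
    \<longleftrightarrow> d^2 = (1 + \<mu>)^2 * a * c"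
proof
  assume "\<exists>p q. quad_form \<mu> a d c = lin_form \<mu> p q [^]\<^bsub>skew_ring \<mu>\<^esub> (2::nat)"
  then show "d^2 = (1 + \<mu>)^2 * a * c"
    by (auto simp: lin_form_square quad_form_eq_iff power_mult_distrib)
next
  assume d: "d^2 = (1 + \<mu>)^2 * a * c"
  obtain p q where pq: "p^2 = a" "q^2 = c"
    using nth_root_exists[of 2 a] nth_root_exists[of 2 c] by auto
  then have "d^2 = ((1 + \<mu>) * p * q)^2"
    using d by (simp add: power_mult_distrib)
  \<comment> \<open>The square roots of a and c match d only up to sign; replacing q by -q corrects
    the sign and keeps q^2.\<close>
  then have "d = (1 + \<mu>) * p * q \<or> d = (1 + \<mu>) * p * (- q)"
    by (simp add: power2_eq_iff)
  then have "quad_form \<mu> a d c = lin_form \<mu> p q [^]\<^bsub>skew_ring \<mu>\<^esub> (2::nat)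
    \<or> quad_form \<mu> a d c = lin_form \<mu> p (- q) [^]\<^bsub>skew_ring \<mu>\<^esub> (2::nat)"
    using pq by (auto simp: lin_form_square)
  then show "\<exists>p q. quad_form \<mu> a d c = lin_form \<mu> p q [^]\<^bsub>skew_ring \<mu>\<^esub> (2::nat)"
    by blast
qed

section \<open>Uniqueness of factorizations\<close>

text \<open>The equations equate two outer products. A nonzero matrix of rank one determines its
  column and row factors up to mutually inverse scalars.\<close>

lemma rank_one_factors_unique:
  fixes p q r s :: "'k::field"
  assumes eq: "p * r = p' * r'" "q * r = q' * r'" "p * s = p' * s'" "q * s = q' * s'"
    and pq: "p \<noteq> 0 \<or> q \<noteq> 0" and rs: "r \<noteq> 0 \<or> s \<noteq> 0"
  shows "\<exists>l. l \<noteq> 0 \<and> p' = l * p \<and> q' = l * q \<and> r' = inverse l * r \<and> s' = inverse l * s"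
proof -
  \<comment> \<open>Stated for arbitrary second factors, so that the case s \<noteq> 0 follows by
    exchanging the roles of r and s.\<close>
  have *: "\<exists>l. l \<noteq> 0 \<and> p' = l * p \<and> q' = l * q \<and> r' = inverse l * r \<and> s' = inverse l * s"
    if eq: "p * r = p' * r'" "q * r = q' * r'" "p * s = p' * s'" "q * s = q' * s'" and "r \<noteq> 0"
    for r r' s s' :: 'k
  proof (intro exI conjI)
    have "r' \<noteq> 0"
      using eq pq \<open>r \<noteq> 0\<close> by auto
    \<comment> \<open>The scalar is forced by r' = l^-1 r.\<close>
    then show l: "r / r' \<noteq> 0" "p' = r / r' * p" "q' = r / r' * q" "r' = inverse (r / r') * r"
      using eq \<open>r \<noteq> 0\<close> by (simp_all add: field_simps)
    have "p * s = p * (r / r' * s')" "q * s = q * (r / r' * s')"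
      using eq(3,4) l(2,3) by (simp_all add: mult_ac)
    \<comment> \<open>Cancel whichever of p and q is nonzero.\<close>
    with pq have "s = r / r' * s'"
      by (metis mult_left_cancel)
    with l(1) show "s' = inverse (r / r') * s"
      by (simp add: field_simps)
  qed
  from rs show ?thesis
  proof
    assume "r \<noteq> 0"
    from *[OF eq this] show ?thesis .
  next
    assume "s \<noteq> 0"
    from *[OF eq(3,4,1,2) this] show ?thesis by blast
  qed
qed

lemma factors_uniquely_iff:
  fixes \<mu> :: "'k::alg_closed_field"
  assumes two: "(2::'k) \<noteq> 0" and \<mu>: "\<mu> \<noteq> 0" and nz: "quad_form \<mu> a (2 * b) c \<noteq> \<zero>\<^bsub>skew_ring \<mu>\<^esub>"
  shows "factors_uniquely \<mu> (quad_form \<mu> a (2 * b) c) \<longleftrightarrow> b^2 = \<mu> * a * c"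
proof -
  let ?Q = "quad_form \<mu> a (2 * b) c"
  have disc: "b^2 = \<mu> * a * c \<longleftrightarrow> p * s = \<mu> * q * r"
    if "?Q = lin_form \<mu> p q \<otimes>\<^bsub>skew_ring \<mu>\<^esub> lin_form \<mu> r s" for p q r s
  proof -
    have eqs: "a = p * r" "2 * b = p * s + \<mu> * q * r" "c = q * s"
      using that by (simp_all add: lin_form_mult quad_form_eq_iff)
    \<comment> \<open>Scaling by 4 brings in 2 b, the coefficient that the factorization determines;
      the factor is cancelled at the end by 2 \<noteq> 0.\<close>
    have "2^2 * (b^2 - \<mu> * a * c) = (2 * b)^2 - 4 * \<mu> * a * c"
      by (simp add: algebra_simps power2_eq_square)
    also have "\<dots> = (p * s - \<mu> * q * r)^2"
      unfolding eqs by (simp add: algebra_simps power2_eq_square)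
    finally have "2^2 * (b^2 - \<mu> * a * c) = 0 \<longleftrightarrow> p * s - \<mu> * q * r = 0"
      by simp
    then show ?thesis
      using power_not_zero[OF two, of 2] unfolding mult_eq_0_iff right_minus_eq by blast
  qed
  obtain p q r s where Q: "?Q = lin_form \<mu> p q \<otimes>\<^bsub>skew_ring \<mu>\<^esub> lin_form \<mu> r s"
    using quad_form_factors[OF \<mu>] by blast
  show ?thesis
  proof
    assume "factors_uniquely \<mu> ?Q"
    moreover have "?Q = lin_form \<mu> r (s / \<mu>) \<otimes>\<^bsub>skew_ring \<mu>\<^esub> lin_form \<mu> p (\<mu> * q)"
      using Q \<mu> by (simp add: lin_form_mult quad_form_eq_iff algebra_simps)
    ultimately obtain l where "lin_form \<mu> r (s / \<mu>) = scal \<mu> l (lin_form \<mu> p q)"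
      using Q unfolding factors_uniquely_def ball_graded_part_1 by blast
    \<comment> \<open>Proportional left factors make both p s and \<mu> q r equal to \<mu> l p
      q.\<close>
    then have "r = l * p" "s = \<mu> * (l * q)"
      using \<mu> by (simp_all add: scal_lin_form lin_form_eq_iff field_simps)
    then show "b^2 = \<mu> * a * c"
      unfolding disc[OF Q] by simp
  next
    assume b: "b^2 = \<mu> * a * c"
    \<comment> \<open>When the discriminant vanishes, both contributions to 2 b equal b. Then Q
      determines all four products of coefficients, so any two factorizations have the same outer
      product.\<close>
    have coeffs: "p * r = a" "\<mu> * q * r = b" "p * s = b" "q * s = c" "p \<noteq> 0 \<or> q \<noteq> 0" "r \<noteq> 0 \<or> s \<noteq> 0"
      if Q: "?Q = lin_form \<mu> p q \<otimes>\<^bsub>skew_ring \<mu>\<^esub> lin_form \<mu> r s" for p q r s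
    proof -
      show eqs: "p * r = a" "q * s = c"
        using Q by (simp_all add: lin_form_mult quad_form_eq_iff)
      have ps: "p * s = \<mu> * q * r"
        using disc[OF Q] b by blast
      moreover have "2 * b = p * s + \<mu> * q * r"
        using Q by (simp add: lin_form_mult quad_form_eq_iff)
      ultimately have "2 * b = 2 * (\<mu> * q * r)"
        by (simp only: mult_2)
      then show *: "\<mu> * q * r = b"
        unfolding mult_left_cancel[OF two] by (rule sym)
      with ps show "p * s = b"
        by simp
      \<comment> \<open>A zero factor would force a = b = c = 0, hence Q = 0.\<close>
      have "\<not> (a = 0 \<and> b = 0 \<and> c = 0)"
        using nz by (auto simp: quad_form_zero)
      with eqs * show "p \<noteq> 0 \<or> q \<noteq> 0" "r \<noteq> 0 \<or> s \<noteq> 0"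
        by auto
    qed
    have "\<exists>l. l \<noteq> 0 \<and> lin_form \<mu> p' q' = scal \<mu> l (lin_form \<mu> p q)
        \<and> lin_form \<mu> r' s' = scal \<mu> (inverse l) (lin_form \<mu> r s)"
      if Q: "?Q = lin_form \<mu> p q \<otimes>\<^bsub>skew_ring \<mu>\<^esub> lin_form \<mu> r s"
        and Q': "?Q = lin_form \<mu> p' q' \<otimes>\<^bsub>skew_ring \<mu>\<^esub> lin_form \<mu> r' s'" for p q r s p' q' r' s'
    proof -
      have "\<mu> * (q * r) = \<mu> * (q' * r')"
        using coeffs(2)[OF Q] coeffs(2)[OF Q'] by (simp add: mult.assoc)
      then have "q * r = q' * r'"
        using \<mu> by simp
      then have "\<exists>l. l \<noteq> 0 \<and> p' = l * p \<and> q' = l * q \<and> r' = inverse l * r \<and> s' = inverse l * s"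
        using coeffs[OF Q] coeffs[OF Q'] by (intro rank_one_factors_unique) simp_all
      then show ?thesis
        unfolding scal_lin_form by blast
    qed
    then show "factors_uniquely \<mu> ?Q"
      unfolding factors_uniquely_def ball_graded_part_1 bex_graded_part_1 using Q by blast
  qed
qed

theorem proposition2p4:
  fixes \<mu>12 \<mu>21 a b c :: "'k::alg_closed_field"
    and Q :: "'k free_algebra set"
    and M :: "'k^2^2"
  assumes "CHAR('k) \<noteq> 2"
    and "\<mu>12 \<noteq> 0"
    and "\<mu>21 = inverse \<mu>12"
    and "Q = quadratic_form \<mu>12 a b c"
    and "Q \<noteq> \<zero>\<^bsub>skew_ring \<mu>12\<^esub>"
    and "M = vector [vector [a, b], vector [\<mu>21 * b, c]]"
  shows "(\<exists>L1 \<in> graded_part \<mu>12 1. \<exists>L2 \<in> graded_part \<mu>12 1. Q = L1 \<otimes>\<^bsub>skew_ring \<mu>12\<^esub> L2)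
    \<and> ((\<exists>L \<in> graded_part \<mu>12 1. Q = L [^]\<^bsub>skew_ring \<mu>12\<^esub> (2::nat)) \<longleftrightarrow> mu_determinant \<mu>12 M = 0)
    \<and> (factors_uniquely \<mu>12 Q \<longleftrightarrow> b^2 = \<mu>12 * a * c)"
proof (intro conjI)
  have Q: "Q = quad_form \<mu>12 a (2 * b) c"
    using assms(4) by (simp add: quadratic_form_eq)
  show "\<exists>L1 \<in> graded_part \<mu>12 1. \<exists>L2 \<in> graded_part \<mu>12 1. Q = L1 \<otimes>\<^bsub>skew_ring \<mu>12\<^esub> L2"
    unfolding bex_graded_part_1 Q using quad_form_factors[OF assms(2)] by blast
  \<comment> \<open>This is the square criterion for \<open>quad_form\<close> at d = 2 b.\<close>
  have "mu_determinant \<mu>12 M = (2 * b)^2 - (1 + \<mu>12)^2 * a * c"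
    by (simp add: mu_determinant_def assms(6) vector_2 power_mult_distrib)
  then show "(\<exists>L \<in> graded_part \<mu>12 1. Q = L [^]\<^bsub>skew_ring \<mu>12\<^esub> (2::nat)) \<longleftrightarrow> mu_determinant \<mu>12 M = 0"
    unfolding bex_graded_part_1 Q quad_form_is_square_iff by simp
  \<comment> \<open>If 2 = 0, the characteristic divides the prime 2; it is not 1 in a field, so it
    would be 2.\<close>
  have "(2::'k) \<noteq> 0"
  proof
    assume "(2::'k) = 0"
    then have "CHAR('k) dvd 2"
      using of_nat_eq_0_iff_char_dvd[of 2, where ?'a = 'k] by simp
    then have "CHAR('k) = 1 \<or> CHAR('k) = 2"
      by (metis two_is_prime_nat prime_nat_iff)
    with assms(1) show False by simp
  qed
  then show "factors_uniquely \<mu>12 Q \<longleftrightarrow> b^2 = \<mu>12 * a * c"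
    using factors_uniquely_iff assms(2,5) unfolding Q by blast
qed

end
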